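(* Fix a tree partition of $\omega$. For all $k,\ell\ge2$: $\mathcal G_k\subseteq\mathcal G_\ell$ if and only if $\ell\mid k$.
   Context: A tree partition of $\omega$ is a family $\langle A_s:s\in\omega^{<\omega}\rangle$ of infinite subsets of $\omega$ such that $A_\varnothing=\omega$, for each $s$ the family $\{A_{s^\frown n}:n\in\omega\}$ is a partition of $A_s$, and any two distinct points of $\omega$ lie in different cells $A_s\neq A_t$ with $|s|=|t|=n$ for some $n$. For $x\in\omega$, $b_x\in\omega^\omega$ is the unique branch with $x\in A_{b_x\upharpoonright n}$ for all $n$; for $x\ne y$, $\Delta(x,y)=\min\{n:b_x(n)\ne b_y(n)\}$. For $k\ge2$, $c_k(\{x,y\})=\Delta(x,y)\bmod k$; a set $H\subseteq\omega$ is $c_k$-homogeneous if $c_k$ is constant on the pairs of elements of $H$; $\mathcal G_k$ is the ideal on $\omega$ generated by the $c_k$-homogeneous sets (and the finite sets). *)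

theory Defs
  imports Complex_Main "HOL.Hull" "HOL-Library.Disjoint_Sets"
begin

text \<open>
  Finite sequences of naturals are lists; \<open>s @ [n]\<close> is the one-point extension of \<open>s\<close> by \<open>n\<close>.
  ``Partition'' is meant for the indexed family: distinct \<open>n\<close> give disjoint cells
  (the cells are nonempty because they are infinite).
\<close>

definition tree_partition :: "(nat list \<Rightarrow> nat set) \<Rightarrow> bool" where
  "tree_partition A \<longleftrightarrow>
     (\<forall>s. infinite (A s)) \<and>
     A [] = UNIV \<and>
     (\<forall>s. disjoint_family (\<lambda>n. A (s @ [n])) \<and> (\<Union>n. A (s @ [n])) = A s) \<and>
     (\<forall>x y. x \<noteq> y \<longrightarrow>
        (\<exists>n s t. length s = n \<and> length t = n \<and> x \<in> A s \<and> y \<in> A t \<and> A s \<noteq> A t))"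

text \<open>
  \<open>map b [0..<n]\<close> is the restriction of \<open>b\<close> to \<open>n\<close>. For a tree partition the branch exists
  and is unique, so the description is proper.
\<close>

definition branch :: "(nat list \<Rightarrow> nat set) \<Rightarrow> nat \<Rightarrow> nat \<Rightarrow> nat" where
  "branch A x = (THE b. \<forall>n. x \<in> A (map b [0..<n]))"

text \<open>Only meaningful for \<open>x \<noteq> y\<close>, where (for a tree partition) the branches differ.\<close>

definition split_level :: "(nat list \<Rightarrow> nat set) \<Rightarrow> nat \<Rightarrow> nat \<Rightarrow> nat" where
  "split_level A x y = (LEAST n. branch A x n \<noteq> branch A y n)"

text \<open>The colour of the unordered pair \<open>{x, y}\<close>; the value is symmetric in \<open>x\<close> and \<open>y\<close>.\<close>

definition pair_colour :: "(nat list \<Rightarrow> nat set) \<Rightarrow> nat \<Rightarrow> nat \<Rightarrow> nat \<Rightarrow> nat" where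
  "pair_colour A k x y = split_level A x y mod k"

definition homogeneous :: "(nat list \<Rightarrow> nat set) \<Rightarrow> nat \<Rightarrow> nat set \<Rightarrow> bool" where
  "homogeneous A k H \<longleftrightarrow>
     (\<exists>c. \<forall>x\<in>H. \<forall>y\<in>H. x \<noteq> y \<longrightarrow> pair_colour A k x y = c)"

text \<open>Properness is not required here, so that every family of sets generates an ideal.\<close>

definition set_ideal :: "'a set set \<Rightarrow> bool" where
  "set_ideal I \<longleftrightarrow>
     {} \<in> I \<and>
     (\<forall>X Y. X \<in> I \<longrightarrow> Y \<subseteq> X \<longrightarrow> Y \<in> I) \<and>
     (\<forall>X Y. X \<in> I \<longrightarrow> Y \<in> I \<longrightarrow> X \<union> Y \<in> I)"

text \<open>\<open>set_ideal hull S\<close> is the least ideal containing \<open>S\<close>.\<close>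

definition G_ideal :: "(nat list \<Rightarrow> nat set) \<Rightarrow> nat \<Rightarrow> nat set set" where
  "G_ideal A k = set_ideal hull ({H. homogeneous A k H} \<union> {F. finite F})"

end

theory Submission
  imports Defs
begin

text \<open>
  If \<open>l\<close> divides \<open>k\<close>, the residue of a level modulo \<open>k\<close> determines its residue modulo \<open>l\<close>, so every
  generator of \<open>G_ideal A k\<close> is already a generator of \<open>G_ideal A l\<close>.

  For the converse, take a set \<open>H\<close> maximal among the sets all of whose splits happen at levels
  divisible by \<open>k\<close>. Maximality makes \<open>H\<close> branch fully at such levels: if \<open>H\<close> meets a cell \<open>A s\<close>
  with \<open>k dvd length s\<close>, then it meets every \<open>A (s @ [n])\<close>
  (\<open>maximal_split_set_branches_fully\<close>).
  Suppose that \<open>H\<close> is covered by finitely many sets \<open>C\<close> homogeneous for \<open>l\<close>. A set \<open>C\<close> with no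
  pair splitting at level \<open>length s\<close> meets at most one cell \<open>A (s @ [n])\<close>, so there is an \<open>n\<close> for which
  every \<open>C\<close> that meets \<open>A (s @ [n])\<close> does have such a pair and hence has the colour
  \<open>length s mod l\<close> (\<open>child_met_only_by_splitting_sets\<close>). Use this first at the root, and then at a cell
  of level \<open>k\<close> below the child found there. The members of the cover that meet the second child
  have colour \<open>0\<close> and also colour \<open>k mod l\<close>. If \<open>l\<close> does not divide \<open>k\<close> these differ, so nothing
  covers the points of \<open>H\<close> in the second child.
\<close>

section \<open>Cells and splitting levels\<close>

context
  fixes A :: "nat list \<Rightarrow> nat set"
  assumes tp: "tree_partition A"
begin

lemma root_cell: "x \<in> A []"
  using tp by (auto simp: tree_partition_def)

lemma child_cell_subset: "A (s @ [n]) \<subseteq> A s"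
  using tp unfolding tree_partition_def by blast

lemma child_cell_exists: "x \<in> A s \<Longrightarrow> \<exists>n. x \<in> A (s @ [n])"
  using tp unfolding tree_partition_def by blast

lemma child_cell_unique:
  assumes "x \<in> A (s @ [m])" "x \<in> A (s @ [n])"
  shows "m = n"
proof -
  have "disjoint_family (\<lambda>n. A (s @ [n]))"
    using tp by (auto simp: tree_partition_def)
  then show ?thesis
    using assms unfolding disjoint_family_on_def by blast
qed

lemma extension_cell_subset: "A (s @ u) \<subseteq> A s"
proof (induction u rule: rev_induct)
  case (snoc n u)
  then show ?case using child_cell_subset[of "s @ u" n] by auto
qed simp

lemma cell_of_length_unique: "x \<in> A s \<Longrightarrow> x \<in> A t \<Longrightarrow> length s = length t \<Longrightarrow> s = t"
proof (induction s arbitrary: t rule: rev_induct)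
  case (snoc m s)
  then obtain t' n where t: "t = t' @ [n]"
    by (cases t rule: rev_cases) auto
  have "x \<in> A s" "x \<in> A t'" "length s = length t'"
    using snoc.prems t child_cell_subset by auto
  then have "s = t'" by (rule snoc.IH)
  then show ?case
    using snoc.prems t child_cell_unique by auto
qed simp

lemma meeting_cells_nested:
  assumes "x \<in> A s" "x \<in> A t" "length s \<le> length t"
  shows "A t \<subseteq> A s"
proof -
  have sub: "A t \<subseteq> A (take (length s) t)"
    using extension_cell_subset[of "take (length s) t" "drop (length s) t"] by simp
  then have "x \<in> A (take (length s) t)"
    using assms(2) by blast
  then have "s = take (length s) t"
    by (rule cell_of_length_unique[OF assms(1)]) (use assms(3) in simp)
  then show ?thesis using sub by (simp only:)
qed

lemma branch_exists: "\<exists>b. \<forall>n. x \<in> A (map b [0..<n])"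
proof -
  define f where "f s = (SOME n. x \<in> A (s @ [n]))" for s
  define S where "S = rec_nat [] (\<lambda>_ s. s @ [f s])"
  have S: "S 0 = []" "S (Suc n) = S n @ [f (S n)]" for n
    by (auto simp: S_def)
  have "map (\<lambda>n. f (S n)) [0..<n] = S n" for n
    by (induction n) (auto simp: S)
  moreover have "x \<in> A (S n)" for n
  proof (induction n)
    case (Suc n)
    then show ?case
      unfolding S f_def by (rule someI_ex[OF child_cell_exists])
  qed (simp add: S root_cell)
  ultimately have "\<forall>n. x \<in> A (map (\<lambda>n. f (S n)) [0..<n])" by simp
  then show ?thesis by blast
qed

lemma mem_cell_along_branch: "x \<in> A (map (branch A x) [0..<n])"
proof -
  have uniq: "b = b'"
    if b: "\<forall>n. x \<in> A (map b [0..<n])" and b': "\<forall>n. x \<in> A (map b' [0..<n])" for b b'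
  proof
    fix n
    have "map b [0..<Suc n] = map b' [0..<Suc n]"
      using b[rule_format, of "Suc n"] b'[rule_format, of "Suc n"]
      by (rule cell_of_length_unique) simp
    then show "b n = b' n" by simp
  qed
  obtain b where b: "\<forall>n. x \<in> A (map b [0..<n])"
    using branch_exists[of x] by (rule exE)
  have "branch A x = b"
    unfolding branch_def
  proof (rule the_equality)
    show "\<forall>n. x \<in> A (map b [0..<n])" by (rule b)
    show "b' = b" if "\<forall>n. x \<in> A (map b' [0..<n])" for b'
      using that b by (rule uniq)
  qed
  then show ?thesis using b by simp
qed

lemma mem_cell_iff: "x \<in> A s \<longleftrightarrow> map (branch A x) [0..<length s] = s"
proof
  assume "x \<in> A s"
  then show "map (branch A x) [0..<length s] = s"
    by (rule cell_of_length_unique[OF mem_cell_along_branch]) simp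
next
  assume "map (branch A x) [0..<length s] = s"
  then show "x \<in> A s"
    using mem_cell_along_branch[of x "length s"] by (simp only:)
qed

text \<open>
  The next two lemmas give \<open>split_level\<close> in terms of cells: two points split at level \<open>length s\<close>
  exactly when they lie in different children of \<open>A s\<close>.
\<close>

lemma split_level_of_children:
  assumes "x \<in> A (s @ [m])" "y \<in> A (s @ [n])" "m \<noteq> n"
  shows "split_level A x y = length s"
  unfolding split_level_def
proof (rule Least_equality)
  have mx: "map (branch A x) [0..<length s] = s" "branch A x (length s) = m"
    using assms(1) by (simp_all add: mem_cell_iff)
  have my: "map (branch A y) [0..<length s] = s" "branch A y (length s) = n"
    using assms(2) by (simp_all add: mem_cell_iff)
  show "branch A x (length s) \<noteq> branch A y (length s)" using mx my assms(3) by simp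
  fix i assume i: "branch A x i \<noteq> branch A y i"
  show "length s \<le> i"
  proof (rule ccontr)
    assume "\<not> length s \<le> i"
    moreover have "map (branch A x) [0..<length s] ! i = map (branch A y) [0..<length s] ! i"
      using mx my by simp
    ultimately show False using i by simp
  qed
qed

lemma distinct_points_split:
  assumes "x \<noteq> y"
  obtains s m n where "x \<in> A (s @ [m])" "y \<in> A (s @ [n])" "m \<noteq> n"
proof -
  obtain s t where "length s = length t" "x \<in> A s" "y \<in> A t" "A s \<noteq> A t"
    using tp assms unfolding tree_partition_def by metis
  then have "branch A x \<noteq> branch A y"
    by (metis mem_cell_iff)
  then have ex: "\<exists>i. branch A x i \<noteq> branch A y i" by auto
  define d where "d = (LEAST i. branch A x i \<noteq> branch A y i)"
  have d: "branch A x d \<noteq> branch A y d"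
    unfolding d_def using ex by (rule LeastI_ex)
  have eq: "map (branch A y) [0..<d] = map (branch A x) [0..<d]"
  proof (rule map_cong[OF refl])
    show "branch A y i = branch A x i" if "i \<in> set [0..<d]" for i
      using not_less_Least[of i "\<lambda>i. branch A x i \<noteq> branch A y i"] that
      unfolding d_def by simp
  qed
  show ?thesis
    by (rule that[of "map (branch A x) [0..<d]" "branch A x d" "branch A y d"])
      (use d eq in \<open>simp_all add: mem_cell_iff\<close>)
qed

section \<open>A maximal set splitting only at multiples of k\<close>

text \<open>
  If \<open>H\<close> met \<open>A s\<close> but missed \<open>A (s @ [n])\<close>, any point of \<open>A (s @ [n])\<close> could be added to \<open>H\<close>: it splits
  from the points of \<open>H\<close> in \<open>A s\<close> at level \<open>length s\<close>, and from the others where they already split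
  from \<open>H \<inter> A s\<close>.
\<close>

lemma maximal_split_set_branches_fully:
  obtains H where
    "\<And>x y. x \<in> H \<Longrightarrow> y \<in> H \<Longrightarrow> x \<noteq> y \<Longrightarrow> k dvd split_level A x y"
    "\<And>s n. k dvd length s \<Longrightarrow> H \<inter> A s \<noteq> {} \<Longrightarrow> H \<inter> A (s @ [n]) \<noteq> {}"
    "H \<noteq> {}"
proof -
  define F where "F = {H. \<forall>x\<in>H. \<forall>y\<in>H. x \<noteq> y \<longrightarrow> k dvd split_level A x y}"
  have "\<exists>H\<in>F. \<forall>X\<in>F. H \<subseteq> X \<longrightarrow> X = H"
  proof (rule subset_Zorn_nonempty)
    show "F \<noteq> {}" by (auto simp: F_def)
    fix C assume C: "subset.chain F C"
    show "\<Union>C \<in> F"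
      unfolding F_def
    proof (intro CollectI ballI impI)
      fix x y assume "x \<in> \<Union>C" "y \<in> \<Union>C" "x \<noteq> y"
      then obtain X Y where XY: "X \<in> C" "x \<in> X" "Y \<in> C" "y \<in> Y" by blast
      then have "X \<subseteq> Y \<or> Y \<subseteq> X" "X \<in> F" "Y \<in> F"
        using C by (auto simp: subset_chain_def)
      then show "k dvd split_level A x y"
        using XY \<open>x \<noteq> y\<close> unfolding F_def by blast
    qed
  qed
  then obtain H where H: "H \<in> F" and max: "\<And>X. X \<in> F \<Longrightarrow> H \<subseteq> X \<Longrightarrow> X = H" by blast
  have "H \<noteq> {}"
    using max[of "{0}"] by (auto simp: F_def)
  moreover have "H \<inter> A (s @ [n]) \<noteq> {}" if s: "k dvd length s" and meets: "H \<inter> A s \<noteq> {}" for s n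
  proof
    assume empty: "H \<inter> A (s @ [n]) = {}"
    obtain z where z: "z \<in> H" "z \<in> A s" using meets by blast
    have "infinite (A (s @ [n]))" using tp by (auto simp: tree_partition_def)
    then obtain y where y: "y \<in> A (s @ [n])" using infinite_imp_nonempty by blast
    then have ys: "y \<in> A s" using child_cell_subset by blast
    have new: "k dvd split_level A x y \<and> k dvd split_level A y x" if x: "x \<in> H" for x
    proof (cases "x \<in> A s")
      case True
      then obtain m where "x \<in> A (s @ [m])" using child_cell_exists by blast
      moreover have "m \<noteq> n" using calculation empty x by blast
      ultimately show ?thesis
        using y s split_level_of_children by metis
    next
      \<comment> \<open>Seen from outside \<open>A s\<close>, the new point \<open>y\<close> and the old point \<open>z\<close> are indistinguishable.\<close>
      case False
      then obtain t i j where t: "x \<in> A (t @ [i])" "z \<in> A (t @ [j])" "i \<noteq> j"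
        using z distinct_points_split by metis
      have "length (t @ [j]) \<le> length s"
      proof (rule ccontr)
        assume "\<not> length (t @ [j]) \<le> length s"
        then have "A t \<subseteq> A s"
          using meeting_cells_nested[of z s t] z t(2) child_cell_subset[of t j] by auto
        then show False using False t(1) child_cell_subset[of t i] by blast
      qed
      then have "y \<in> A (t @ [j])"
        using meeting_cells_nested[OF t(2) z(2)] ys by blast
      moreover have "k dvd split_level A x z"
        using H x z False unfolding F_def by auto
      ultimately show ?thesis
        using t split_level_of_children by metis
    qed
    then have "insert y H \<in> F"
      using H unfolding F_def by auto
    then show False using max[of "insert y H"] y empty by blast
  qed
  ultimately show ?thesis
    using that[of H] H unfolding F_def by blast
qed

section \<open>Finite covers by homogeneous sets\<close>

text \<open>
  This is where infinite branching enters: a set without a pair splitting at level \<open>length s\<close> can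
  spoil at most one of the infinitely many candidates for \<open>n\<close>.
\<close>

lemma child_met_only_by_splitting_sets:
  assumes "finite \<C>"
  obtains n where
    "\<And>C. C \<in> \<C> \<Longrightarrow> C \<inter> A (s @ [n]) \<noteq> {} \<Longrightarrow>
       \<exists>x\<in>C. \<exists>y\<in>C. x \<noteq> y \<and> split_level A x y = length s"
proof -
  define splits where
    "splits C \<longleftrightarrow> (\<exists>x\<in>C. \<exists>y\<in>C. x \<noteq> y \<and> split_level A x y = length s)" for C
  define hit where "hit C = {n. C \<inter> A (s @ [n]) \<noteq> {}}" for C
  have "finite (hit C)" if C: "\<not> splits C" for C
  proof -
    have "m = n" if mn: "m \<in> hit C" "n \<in> hit C" for m n
    proof (rule ccontr)
      assume "m \<noteq> n"
      obtain x y where xy: "x \<in> C" "x \<in> A (s @ [m])" "y \<in> C" "y \<in> A (s @ [n])"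
        using mn unfolding hit_def by blast
      moreover have "x \<noteq> y" using xy \<open>m \<noteq> n\<close> child_cell_unique by blast
      ultimately show False
        using C \<open>m \<noteq> n\<close> split_level_of_children unfolding splits_def by blast
    qed
    then have "hit C \<subseteq> {m}" if "m \<in> hit C" for m using that by blast
    then show ?thesis using finite_subset finite.intros by (metis equals0I)
  qed
  then have "finite (\<Union>C\<in>{C\<in>\<C>. \<not> splits C}. hit C)"
    using assms by auto
  then obtain n where "n \<notin> (\<Union>C\<in>{C\<in>\<C>. \<not> splits C}. hit C)"
    using ex_new_if_finite infinite_UNIV_nat by blast
  then show ?thesis
    using that[of n] unfolding splits_def hit_def by blast
qed

text \<open>
  One application of the previous lemma pins the colour of the relevant members of a cover to that
  of one level; a second one, \<open>k\<close> levels further down, forces a different colour on them.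
\<close>

lemma homogeneous_set_not_finitely_covered:
  assumes "k > 0" "\<not> l dvd k"
  obtains H where "homogeneous A k H"
    "\<And>\<C>. finite \<C> \<Longrightarrow> (\<And>C. C \<in> \<C> \<Longrightarrow> homogeneous A l C) \<Longrightarrow> \<not> H \<subseteq> \<Union>\<C>"
proof -
  obtain H where H: "\<And>x y. x \<in> H \<Longrightarrow> y \<in> H \<Longrightarrow> x \<noteq> y \<Longrightarrow> k dvd split_level A x y"
    and full: "\<And>s n. k dvd length s \<Longrightarrow> H \<inter> A s \<noteq> {} \<Longrightarrow> H \<inter> A (s @ [n]) \<noteq> {}"
    and "H \<noteq> {}"
    by (rule maximal_split_set_branches_fully[of k]) (rule that)
  have "homogeneous A k H"
    unfolding homogeneous_def pair_colour_def using H by (intro exI[of _ 0]) auto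
  moreover have "\<not> H \<subseteq> \<Union>\<C>"
    if fin: "finite \<C>" and hom: "\<And>C. C \<in> \<C> \<Longrightarrow> homogeneous A l C" for \<C>
  proof
    assume cover: "H \<subseteq> \<Union>\<C>"
    obtain m where m: "\<And>C. C \<in> \<C> \<Longrightarrow> C \<inter> A ([] @ [m]) \<noteq> {} \<Longrightarrow>
        \<exists>x\<in>C. \<exists>y\<in>C. x \<noteq> y \<and> split_level A x y = length ([] :: nat list)"
      by (rule child_met_only_by_splitting_sets[OF fin, of "[]"]) (rule that)
    have "H \<inter> A ([] @ [m]) \<noteq> {}"
      by (rule full) (use \<open>H \<noteq> {}\<close> root_cell in auto)
    then obtain x where x: "x \<in> H" "x \<in> A [m]" by auto
    define t where "t = map (branch A x) [0..<k]"
    have t: "x \<in> A t" "length t = k"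
      by (simp_all add: t_def mem_cell_along_branch)
    obtain n where n: "\<And>C. C \<in> \<C> \<Longrightarrow> C \<inter> A (t @ [n]) \<noteq> {} \<Longrightarrow>
        \<exists>x\<in>C. \<exists>y\<in>C. x \<noteq> y \<and> split_level A x y = length t"
      by (rule child_met_only_by_splitting_sets[OF fin, of t]) (rule that)
    obtain y where y: "y \<in> H" "y \<in> A (t @ [n])"
      using full[of t n] x t by auto
    \<comment> \<open>Here \<open>k > 0\<close> matters: level \<open>k\<close> lies at or below the child of the root.\<close>
    have "A t \<subseteq> A [m]"
      by (rule meeting_cells_nested[OF x(2) t(1)]) (use t(2) assms(1) in simp)
    then have "y \<in> A [m]"
      using y child_cell_subset by blast
    obtain C where C: "C \<in> \<C>" "y \<in> C" using cover y by blast
    have "\<exists>x\<in>C. \<exists>y\<in>C. x \<noteq> y \<and> split_level A x y = 0"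
      using m[OF C(1)] C(2) \<open>y \<in> A [m]\<close> by auto
    moreover have "\<exists>x\<in>C. \<exists>y\<in>C. x \<noteq> y \<and> split_level A x y = k"
      using n[OF C(1)] C(2) y t by auto
    ultimately have "k mod l = 0 mod l"
      using hom[OF C(1)] unfolding homogeneous_def pair_colour_def by metis
    then show False using assms by auto
  qed
  ultimately show ?thesis using that[of H] by blast
qed

end

section \<open>Inclusion of the ideals\<close>

text \<open>
  The sets with a finite homogeneous cover form an ideal. It contains the finite sets because
  singletons are homogeneous.
\<close>

lemma G_ideal_finitely_covered:
  assumes "X \<in> G_ideal A l"
  obtains \<C> where "finite \<C>" "\<And>C. C \<in> \<C> \<Longrightarrow> homogeneous A l C" "X \<subseteq> \<Union>\<C>"
proof -
  define I where
    "I = {X. \<exists>\<C>. finite \<C> \<and> (\<forall>C\<in>\<C>. homogeneous A l C) \<and> X \<subseteq> \<Union>\<C>}"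
  have "G_ideal A l \<subseteq> I"
    unfolding G_ideal_def
  proof (rule hull_minimal)
    have "H \<in> I" if "homogeneous A l H" for H
      unfolding I_def using that by (intro CollectI exI[of _ "{H}"]) auto
    moreover have "F \<in> I" if "finite F" for F
      unfolding I_def using that
      by (intro CollectI exI[of _ "(\<lambda>x. {x}) ` F"]) (auto simp: homogeneous_def)
    ultimately show "{H. homogeneous A l H} \<union> {F. finite F} \<subseteq> I" by blast
    have "X \<union> Y \<in> I" if X: "X \<in> I" and Y: "Y \<in> I" for X Y
    proof -
      obtain \<C> \<D> where "finite \<C>" "\<forall>C\<in>\<C>. homogeneous A l C" "X \<subseteq> \<Union>\<C>"
        "finite \<D>" "\<forall>C\<in>\<D>. homogeneous A l C" "Y \<subseteq> \<Union>\<D>"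
        using X Y unfolding I_def by blast
      then show ?thesis
        unfolding I_def by (intro CollectI exI[of _ "\<C> \<union> \<D>"]) auto
    qed
    moreover have "{} \<in> I"
      unfolding I_def by (intro CollectI exI[of _ "{}"]) auto
    moreover have "Y \<in> I" if X: "X \<in> I" and sub: "Y \<subseteq> X" for X Y
    proof -
      obtain \<C> where "finite \<C>" "\<forall>C\<in>\<C>. homogeneous A l C" "X \<subseteq> \<Union>\<C>"
        using X unfolding I_def by blast
      then show ?thesis
        unfolding I_def using sub by (intro CollectI exI[of _ \<C>]) auto
    qed
    ultimately show "set_ideal I" by (simp add: set_ideal_def)
  qed
  then have "X \<in> I" using assms by (rule subsetD)
  then obtain \<C> where "finite \<C>" "\<forall>C\<in>\<C>. homogeneous A l C" "X \<subseteq> \<Union>\<C>"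
    unfolding I_def by blast
  then show ?thesis using that[of \<C>] by simp
qed

lemma homogeneous_dvd:
  assumes "l dvd k" "homogeneous A k H"
  shows "homogeneous A l H"
proof -
  have "pair_colour A l x y = pair_colour A k x y mod l" for x y
    using assms(1) by (simp add: pair_colour_def mod_mod_cancel)
  then show ?thesis
    using assms(2) unfolding homogeneous_def by metis
qed

theorem theorem5p5:
  fixes A :: "nat list \<Rightarrow> nat set" and k l :: nat
  assumes "tree_partition A" and "k \<ge> 2" and "l \<ge> 2"
  shows "G_ideal A k \<subseteq> G_ideal A l \<longleftrightarrow> l dvd k"
proof
  assume "l dvd k"
  then show "G_ideal A k \<subseteq> G_ideal A l"
    unfolding G_ideal_def by (intro hull_mono) (auto intro: homogeneous_dvd)
next
  assume sub: "G_ideal A k \<subseteq> G_ideal A l"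
  show "l dvd k"
  proof (rule ccontr)
    assume "\<not> l dvd k"
    then obtain H where H: "homogeneous A k H"
      and uncovered:
        "\<And>\<C>. finite \<C> \<Longrightarrow> (\<And>C. C \<in> \<C> \<Longrightarrow> homogeneous A l C) \<Longrightarrow> \<not> H \<subseteq> \<Union>\<C>"
      using homogeneous_set_not_finitely_covered[OF assms(1), of k l] assms(2) by auto
    have "H \<in> G_ideal A k"
      unfolding G_ideal_def by (rule hull_inc) (use H in simp)
    then have "H \<in> G_ideal A l" using sub by blast
    then show False
      by (rule G_ideal_finitely_covered) (use uncovered in blast)
  qed
qed

end
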